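(* Let $r\ge 2$ be an integer and let $S\subseteq\mathbf{N}$ be multiplicative such that for every prime $p$ one has $\min\{a\ge1: p^a\notin S\}\ge r$ (i.e. $p^a\in S$ for all $1\le a\le r-1$; the minimum of the empty set is taken to be $\infty$). Then $$\sum_{n\le x}\rho_S(n)=d(S)\,x+O(x^{1/r}),$$ where $$d(S)=\prod_p\Bigl(1-\frac1p\Bigr)\Bigl(1+\sum_{a\ge1,\ p^a\in S}\frac1{p^a}\Bigr)$$ (product over all primes) is the asymptotic density of $S$.
   Context: $\rho_S$ denotes the characteristic function of $S$. A set $S\subseteq\mathbf{N}$ is called multiplicative if $1\in S$ and $\rho_S$ is a multiplicative function. *)

theory Defs
  imports
    "HOL-Analysis.Analysis"
    "HOL-Library.Landau_Symbols"
    "HOL-Library.Extended_Nat"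
    "HOL-Computational_Algebra.Primes"
begin

text \<open>
  Arithmetic functions are functions on \<^typ>\<open>nat\<close> of which only the values at positive
  arguments matter.
\<close>

definition multiplicative_fun :: "(nat \<Rightarrow> 'a :: comm_semiring_1) \<Rightarrow> bool" where
  "multiplicative_fun f \<longleftrightarrow>
     f 1 = 1 \<and> (\<forall>m>0. \<forall>n>0. coprime m n \<longrightarrow> f (m * n) = f m * f n)"

text \<open>The natural numbers \<open>\<^bold>N\<close> start at 1 here, so a multiplicative set does not contain 0.\<close>

definition multiplicative_set :: "nat set \<Rightarrow> bool" where
  "multiplicative_set S \<longleftrightarrow>
     S \<subseteq> {1..} \<and> 1 \<in> S \<and> multiplicative_fun (indicator S :: nat \<Rightarrow> real)"

text \<open>
  \<open>min {a \<ge> 1. p ^ a \<notin> S}\<close>; in \<^typ>\<open>enat\<close> the infimum of the empty set is \<open>\<infinity>\<close>, and a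
  nonempty set attains its infimum.
\<close>

definition first_missing_exponent :: "nat set \<Rightarrow> nat \<Rightarrow> enat" where
  "first_missing_exponent S p = (INF a\<in>{a. a \<ge> 1 \<and> p ^ a \<notin> S}. enat a)"

definition density_factor :: "nat set \<Rightarrow> nat \<Rightarrow> real" where
  "density_factor S p =
     (1 - 1 / real p) * (1 + (\<Sum>\<^sub>\<infinity>a\<in>{a. a \<ge> 1 \<and> p ^ a \<in> S}. 1 / real p ^ a))"

text \<open>
  The product over all primes, written as a product over all natural numbers in which the
  non-primes contribute 1.  \<^const>\<open>prodinf\<close> is meaningful only if the product converges
  (in particular, does not diverge to 0).
\<close>

definition prime_density_factor :: "nat set \<Rightarrow> nat \<Rightarrow> real" where
  "prime_density_factor S p = (if prime p then density_factor S p else 1)"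

definition density_product :: "nat set \<Rightarrow> real" where
  "density_product S = prodinf (prime_density_factor S)"

definition has_asymptotic_density :: "nat set \<Rightarrow> real \<Rightarrow> bool" where
  "has_asymptotic_density S d \<longleftrightarrow>
     (\<lambda>n. real (card (S \<inter> {1..n})) / real n) \<longlonglongrightarrow> d"

end

theory Submission
  imports Defs
begin

text \<open>
  Let \<open>\<rho>\<close> be the indicator of \<open>S\<close> and write \<open>\<rho> = 1 * g\<close> as a Dirichlet convolution.  Then \<open>g\<close> is
  multiplicative with \<open>g(p\<^sup>a) = \<rho>(p\<^sup>a) - \<rho>(p\<^bsup>a-1\<^esup>)\<close>, so \<open>|g| \<le> 1\<close> and \<open>g\<close> is supported on the
  \<open>r\<close>-full numbers, those in which every prime factor has multiplicity at least \<open>r\<close>.  There are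
  \<open>O(x\<^bsup>1/r\<^esup>)\<close> of them up to \<open>x\<close>, so that
  \<open>\<Sum>\<^bsub>n\<le>x\<^esub> \<rho>(n) = \<Sum>\<^bsub>d\<le>x\<^esub> g(d) \<lfloor>x/d\<rfloor> = x \<Sum>\<^bsub>d\<^esub> g(d)/d + O(x\<^bsup>1/r\<^esup>)\<close>,
  both the rounding errors and the tail \<open>x \<Sum>\<^bsub>d>x\<^esub> |g(d)|/d\<close> being of that order.  The Euler product
  of \<open>\<Sum>\<^bsub>d\<^esub> g(d)/d\<close> is \<open>d(S)\<close>.
\<close>

section \<open>Multiplicative functions given by their values at prime powers\<close>

text \<open>Strong induction that splits off the full power of one prime factor at each step and
  leaves a smaller cofactor. As the cofactor is prime to \<open>p\<close>, identities between
  multiplicative functions reduce to adjoining one new prime power.\<close>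

lemma prime_power_cofactor_induct [consumes 1, case_names 1 prime_power]:
  fixes n :: nat
  assumes "n > 0"
    and one: "P 1"
    and step: "\<And>p a m. \<lbrakk>prime p; \<not> p dvd m; m > 0; a > 0; P m\<rbrakk> \<Longrightarrow> P (m * p ^ a)"
  shows "P n"
  using assms(1)
proof (induction n rule: less_induct)
  case (less n)
  show ?case
  proof (cases "n = 1")
    case False
    then obtain p where p: "prime p" "p dvd n"
      using prime_factor_nat by blast
    obtain m where m: "n = p ^ multiplicity p n * m" "\<not> p dvd m"
      using multiplicity_decompose'[of n p] less.prems p(1) by (metis not_gr_zero not_prime_unit)
    define a where "a = multiplicity p n"
    have a: "a > 0"
      using p less.prems unfolding a_def by (simp add: prime_multiplicity_gt_zero_iff)
    have n: "n = m * p ^ a"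
      using m(1) by (simp add: a_def mult.commute)
    have m0: "m > 0"
      using n less.prems by (cases m) auto
    have "p ^ a > 1"
      using a prime_gt_1_nat[OF p(1)] by (intro one_less_power) auto
    then have "m < n"
      using n m0 by simp
    then show ?thesis
      using step[OF p(1) m(2) m0 a] less.IH m0 n by blast
  qed (use one in simp)
qed

text \<open>The value at 0 is the empty product 1, because \<^term>\<open>prime_factors 0\<close> is empty.\<close>

definition multiplicative_ext :: "(nat \<Rightarrow> nat \<Rightarrow> real) \<Rightarrow> nat \<Rightarrow> real" where
  "multiplicative_ext w n = (\<Prod>p\<in>prime_factors n. w p (multiplicity p n))"

lemma multiplicative_ext_1 [simp]: "multiplicative_ext w (Suc 0) = 1"
  by (simp add: multiplicative_ext_def)

text \<open>The new prime adds one factor and leaves the other multiplicities alone. The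
  normalisation \<open>w p 0 = 1\<close> covers \<open>a = 0\<close>, where \<open>p\<close> is not
  among the prime factors.\<close>

lemma multiplicative_ext_mult_prime_power:
  fixes p m :: nat
  assumes p: "prime p" and pm: "\<not> p dvd m" and m: "m > 0" and w: "w p 0 = 1"
  shows "multiplicative_ext w (m * p ^ a) = multiplicative_ext w m * w p a"
proof (cases "a = 0")
  case False
  have p0: "p > 0" using p by (simp add: prime_gt_0_nat)
  have pf: "prime_factors (m * p ^ a) = insert p (prime_factors m)"
    using m p0 False p by (auto simp: prime_factors_dvd prime_dvd_mult_iff prime_dvd_power_iff primes_dvd_imp_eq)
  have mp: "multiplicity p (m * p ^ a) = a"
    using p pm m p0 by (subst prime_elem_multiplicity_mult_distrib)
      (auto simp: not_dvd_imp_multiplicity_0)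
  have mq: "multiplicity q (m * p ^ a) = multiplicity q m" if "q \<in> prime_factors m" for q
  proof -
    have q: "prime q" "q dvd m" using that by auto
    then have "q \<noteq> p" using pm by auto
    then show ?thesis
      using q p m p0 by (subst prime_elem_multiplicity_mult_distrib)
        (auto simp: prime_multiplicity_other prime_elem_multiplicity_power_distrib)
  qed
  have "p \<notin> prime_factors m" using pm by auto
  then show ?thesis
    unfolding multiplicative_ext_def pf
    by (subst prod.insert) (auto simp: mp mq cong: prod.cong)
qed (use w in simp)

text \<open>The exponent is recovered as the multiplicity of \<open>p\<close>; 0 cannot lie in
  \<open>D\<close>, since \<open>p\<close> divides it. Used both for divisor sums and for Euler
  products.\<close>

lemma inj_on_times_prime_power:
  fixes p :: nat
  assumes p: "prime p" and D: "\<And>d. d \<in> D \<Longrightarrow> \<not> p dvd d"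
  shows "inj_on (\<lambda>(d, a). d * p ^ a) (D \<times> E)"
proof (rule inj_onI, clarify)
  fix d a d' a' assume h: "d \<in> D" "d' \<in> D" "d * p ^ a = d' * p ^ a'"
  have nz: "d \<noteq> 0" "d' \<noteq> 0" "p \<noteq> 0" using D h p by (metis dvd_0_right, metis dvd_0_right, auto)
  have "multiplicity p (x * p ^ b) = b" if "x \<in> D" for x b
    using that D[OF that] p nz
    by (subst prime_elem_multiplicity_mult_distrib) (auto simp: not_dvd_imp_multiplicity_0 intro!: Nat.gr0I)
  then have "a = a'" using h by metis
  then show "d = d' \<and> a = a'" using h nz by simp
qed

lemma divisors_mult_prime_power:
  fixes p m :: nat
  assumes p: "prime p" and pm: "\<not> p dvd m"
  shows "{d. d dvd m * p ^ k} = (\<lambda>(d, a). d * p ^ a) ` ({d. d dvd m} \<times> {..k})"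
proof (intro equalityI subsetI)
  fix d assume "d \<in> {d. d dvd m * p ^ k}"
  then obtain x y where xy: "d = x * y" "x dvd m" "y dvd p ^ k"
    using division_decomp by blast
  obtain a where "a \<le> k" "y = p ^ a"
    using xy(3) p divides_primepow_nat by blast
  then show "d \<in> (\<lambda>(d, a). d * p ^ a) ` ({d. d dvd m} \<times> {..k})"
    using xy by force
qed (auto intro: mult_dvd_mono le_imp_power_dvd)

text \<open>Convolution with the constant 1 acts at each prime separately, replacing local values by
  their partial sums. When the local values are differences these sums telescope, which recovers the
  indicator of \<open>S\<close> from \<open>g\<close>.\<close>

lemma sum_divisors_multiplicative_ext:
  fixes n :: nat
  assumes "n > 0" and w: "\<And>p. w p 0 = 1"
  shows "(\<Sum>d | d dvd n. multiplicative_ext w d) = multiplicative_ext (\<lambda>p a. \<Sum>b\<le>a. w p b) n"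
  using assms(1)
proof (induction n rule: prime_power_cofactor_induct)
  case (prime_power p a m)
  have "(\<Sum>d | d dvd m * p ^ a. multiplicative_ext w d)
      = (\<Sum>(d, b)\<in>{d. d dvd m} \<times> {..a}. multiplicative_ext w (d * p ^ b))"
    unfolding divisors_mult_prime_power[OF prime_power(1,2)]
    using prime_power(2)
    by (subst sum.reindex) (auto intro!: inj_on_times_prime_power prime_power(1) sum.cong dest: dvd_trans)
  also have "\<dots> = (\<Sum>(d, b)\<in>{d. d dvd m} \<times> {..a}. multiplicative_ext w d * w p b)"
  proof (intro sum.cong refl, clarify)
    fix d b assume "d dvd m"
    then show "multiplicative_ext w (d * p ^ b) = multiplicative_ext w d * w p b"
      using prime_power
      by (intro multiplicative_ext_mult_prime_power w) (auto dest: dvd_trans intro: Nat.gr0I)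
  qed
  also have "\<dots> = (\<Sum>d | d dvd m. multiplicative_ext w d) * (\<Sum>b\<le>a. w p b)"
    by (simp add: sum_product sum.cartesian_product)
  also have "\<dots> = multiplicative_ext (\<lambda>p a. \<Sum>b\<le>a. w p b) (m * p ^ a)"
    unfolding prime_power.IH
    by (rule multiplicative_ext_mult_prime_power[symmetric]) (use prime_power w in auto)
  finally show ?case .
qed simp

lemma multiplicative_ext_prime_powers:
  fixes f :: "nat \<Rightarrow> real"
  assumes "multiplicative_fun f" and "n > 0"
  shows "multiplicative_ext (\<lambda>p a. f (p ^ a)) n = f n"
  using assms(2)
proof (induction n rule: prime_power_cofactor_induct)
  case 1
  then show ?case using assms(1) by (simp add: multiplicative_fun_def)
next
  case (prime_power p a m)
  have "coprime m (p ^ a)"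
    using prime_power(1,2) by (metis coprime_commute coprime_power_right_iff prime_imp_coprime)
  moreover have "p ^ a > 0" using prime_power(1) by (simp add: prime_gt_0_nat)
  ultimately have "f (m * p ^ a) = f m * f (p ^ a)"
    using assms(1) prime_power(3) by (simp add: multiplicative_fun_def)
  moreover have "f (p ^ 0) = 1" using assms(1) by (simp add: multiplicative_fun_def)
  ultimately show ?case
    using prime_power multiplicative_ext_mult_prime_power[of p m "\<lambda>p a. f (p ^ a)" a] by simp
qed

section \<open>Counting r-full numbers\<close>

text \<open>
  The products \<open>a\<^sub>0\<^bsup>k\<^esup> a\<^sub>1\<^bsup>k+1\<^esup> \<dots>\<close> of \<open>m\<close> positive powers.  For \<open>k = m = r\<close> they include all \<open>r\<close>-full
  numbers, since every exponent \<open>v \<ge> r\<close> has the form \<open>r q + (r + j)\<close> with \<open>j < r\<close>.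
\<close>

primrec power_products :: "nat \<Rightarrow> nat \<Rightarrow> nat set" where
  "power_products k 0 = {1}"
| "power_products k (Suc m) = {a ^ k * b | a b. a > 0 \<and> b \<in> power_products (Suc k) m}"

lemma power_products_pos: "n \<in> power_products k m \<Longrightarrow> n > 0"
  by (induction m arbitrary: k n) auto

lemma one_in_power_products: "1 \<in> power_products k m"
proof (induction m arbitrary: k)
  case (Suc m)
  have "(1::nat) = 1 ^ k * 1" by simp
  then show ?case unfolding power_products.simps using Suc[of "Suc k"] by blast
qed simp

lemma power_products_mult:
  "x \<in> power_products k m \<Longrightarrow> y \<in> power_products k m \<Longrightarrow> x * y \<in> power_products k m"
proof (induction m arbitrary: k x y)
  case (Suc m)
  from Suc.prems obtain a b c d where h: "x = a ^ k * b" "y = c ^ k * d" "a > 0" "c > 0"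
    "b \<in> power_products (Suc k) m" "d \<in> power_products (Suc k) m"
    by auto
  have "x * y = (a * c) ^ k * (b * d)"
    using h by (simp add: power_mult_distrib)
  moreover have "a * c > 0" "b * d \<in> power_products (Suc k) m"
    using h Suc.IH by auto
  ultimately show ?case unfolding power_products.simps by blast
qed simp

lemma power_in_power_products:
  "a > 0 \<Longrightarrow> i < m \<Longrightarrow> a ^ (k + i) \<in> power_products k m"
proof (induction m arbitrary: k i)
  case (Suc m)
  show ?case
  proof (cases i)
    case 0
    then show ?thesis using one_in_power_products[of "Suc k" m] Suc.prems by force
  next
    case i: (Suc j)
    then have "a ^ (Suc k + j) \<in> power_products (Suc k) m"
      using Suc.IH[of j "Suc k"] Suc.prems by simp
    moreover have "a ^ (k + i) = 1 ^ k * a ^ (Suc k + j)" using i by simp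
    ultimately show ?thesis unfolding power_products.simps by blast
  qed
qed simp

lemma large_power_in_power_products:
  assumes "a > 0" "r > 0" "v \<ge> r"
  shows "a ^ v \<in> power_products r r"
proof -
  have "v div r > 0" using assms by (simp add: div_greater_zero_iff)
  \<comment> \<open>One unit of the quotient \<open>v div r\<close> joins the remainder, giving an
    exponent from \<open>r\<close> to \<open>2 * r - 1\<close> as in
    \<open>power_in_power_products\<close>; what is left is an \<open>r\<close>-th power.\<close>
  then have "v = r * (v div r - 1) + (r + v mod r)"
    by (metis One_nat_def Suc_pred add.assoc add.commute mult_Suc_right mult_div_mod_eq)
  then have "a ^ v = (a ^ (v div r - 1)) ^ (r + 0) * a ^ (r + v mod r)"
    by (metis Nat.add_0_right mult.commute power_add power_mult)
  then show ?thesis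
    using assms by (metis power_products_mult power_in_power_products mod_less_divisor zero_less_power)
qed

lemma full_in_power_products:
  assumes "n > 0" "r > 0" "\<And>p. p \<in> prime_factors n \<Longrightarrow> multiplicity p n \<ge> r"
  shows "n \<in> power_products r r"
proof -
  \<comment> \<open>Inducting over sets of prime factors keeps \<open>n\<close>, and hence the
    multiplicities, fixed.\<close>
  have "(\<Prod>p\<in>A. p ^ multiplicity p n) \<in> power_products r r" if "finite A" "A \<subseteq> prime_factors n" for A
    using that
  proof (induction A rule: finite_induct)
    case empty
    then show ?case using one_in_power_products by simp
  next
    case (insert p A)
    have "p ^ multiplicity p n \<in> power_products r r"
      using insert.prems assms
      by (intro large_power_in_power_products) (auto intro: prime_gt_0_nat)
    then show ?case
      using insert by (auto intro!: power_products_mult)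
  qed
  then show ?thesis
    using prime_factorization_nat[OF assms(1)] by (metis finite_set_mset subset_refl)
qed

text \<open>One prime whose exponent lies strictly between 0 and \<open>r\<close> makes the product
  vanish. Without such a prime \<open>n\<close> is \<open>r\<close>-full, and all factors are at
  most 1 in absolute value.\<close>

lemma multiplicative_ext_bound:
  assumes "r > 0" "n > 0"
    and "\<And>p a. prime p \<Longrightarrow> \<bar>w p a\<bar> \<le> 1"
    and "\<And>p a. prime p \<Longrightarrow> 0 < a \<Longrightarrow> a < r \<Longrightarrow> w p a = 0"
  shows "\<bar>multiplicative_ext w n\<bar> \<le> indicator (power_products r r) n"
proof (cases "\<forall>p\<in>prime_factors n. multiplicity p n \<ge> r")
  case True
  then have "n \<in> power_products r r" using full_in_power_products assms by blast
  moreover have "\<bar>multiplicative_ext w n\<bar> \<le> 1"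
    unfolding multiplicative_ext_def abs_prod using assms(3) by (intro prod_le_1) auto
  ultimately show ?thesis by simp
next
  case False
  then obtain p where p: "p \<in> prime_factors n" "multiplicity p n < r" by auto
  have "w p (multiplicity p n) = 0"
    using p assms(2) by (intro assms(4)) (auto simp: prime_multiplicity_gt_zero_iff prime_factors_dvd)
  then have "multiplicative_ext w n = 0"
    unfolding multiplicative_ext_def using p by auto
  then show ?thesis by simp
qed

text \<open>Because \<alpha> < s, dyadic blocks contribute a convergent geometric series. Bounding
  finite sets \<open>F\<close> uniformly yields summability and, through the power of
  \<open>M\<close>, tail estimates as well.\<close>

lemma dyadic_tail_bound:
  fixes A :: "nat set" and C \<alpha> s :: real
  assumes card: "\<And>N. real (card (A \<inter> {1..N})) \<le> C * real N powr \<alpha>"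
    and \<alpha>: "\<alpha> < s" and s: "s > 0"
  shows "\<exists>C'\<ge>0. \<forall>M\<ge>1. \<forall>F. finite F \<longrightarrow> F \<subseteq> A \<inter> {M..} \<longrightarrow>
           (\<Sum>n\<in>F. real n powr (- s)) \<le> C' * real M powr (\<alpha> - s)"
proof -
  define q where "q = (2::real) powr (\<alpha> - s)"
  have q: "0 < q" "q < 1" using \<alpha> by (auto simp: q_def powr_less_one)
  have C: "C \<ge> 0" using card[of 1] by (simp add: order_trans[OF of_nat_0_le_iff])
  \<comment> \<open>Over the dyadic block from \<open>2\<^sup>K M\<close> to \<open>2\<^bsup>K+1\<^esup> M\<close> the sum is at most a constant times \<open>M\<^bsup>\<alpha>-s\<^esup> q\<^sup>K\<close>.\<close>
  define B where "B M K = (\<Sum>n\<in>A \<inter> {M..<2 ^ K * M}. real n powr (- s))" for M K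
  have block: "(\<Sum>n\<in>A \<inter> {2 ^ K * M..<2 ^ Suc K * M}. real n powr (- s))
                 \<le> C * 2 powr \<alpha> * real M powr (\<alpha> - s) * q ^ K" if M: "M \<ge> 1" for M K :: nat
  proof -
    let ?X = "A \<inter> {2 ^ K * M..<2 ^ Suc K * M}"
    have X1: "2 ^ K * M \<ge> 1" using M by simp
    have "(\<Sum>n\<in>?X. real n powr (- s)) \<le> (\<Sum>n\<in>?X. real (2 ^ K * M) powr (- s))"
    proof (rule sum_mono)
      fix n assume "n \<in> ?X"
      then have "real (2 ^ K * M) \<le> real n" by (simp only: of_nat_le_iff) simp
      then show "real n powr (- s) \<le> real (2 ^ K * M) powr (- s)"
        using s M by (intro powr_mono2') auto
    qed
    also have "\<dots> = real (card ?X) * real (2 ^ K * M) powr (- s)" by simp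
    also have "\<dots> \<le> real (card (A \<inter> {1..2 ^ Suc K * M})) * real (2 ^ K * M) powr (- s)"
    proof (intro mult_right_mono)
      have "?X \<subseteq> A \<inter> {1..2 ^ Suc K * M}" using X1 by auto
      then show "real (card ?X) \<le> real (card (A \<inter> {1..2 ^ Suc K * M}))"
        by (simp add: card_mono)
    qed simp
    also have "\<dots> \<le> C * real (2 ^ Suc K * M) powr \<alpha> * real (2 ^ K * M) powr (- s)"
      by (intro mult_right_mono card) simp
    also have "\<dots> = C * 2 powr \<alpha> * real M powr (\<alpha> - s) * q ^ K"
      using M by (simp add: q_def powr_mult powr_diff powr_minus powr_powr powr_power
          mult_ac divide_simps flip: powr_realpow)
    finally show ?thesis .
  qed
  have B: "B M K \<le> C * 2 powr \<alpha> * real M powr (\<alpha> - s) * (\<Sum>k<K. q ^ k)" if M: "M \<ge> 1" for M K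
  proof (induction K)
    case (Suc K)
    have "M \<le> 2 ^ K * M" "2 ^ K * M \<le> 2 ^ Suc K * M" by simp_all
    then have "A \<inter> {M..<2 ^ Suc K * M} = A \<inter> {M..<2 ^ K * M} \<union> A \<inter> {2 ^ K * M..<2 ^ Suc K * M}"
      by (auto simp only: Int_Un_distrib[symmetric] ivl_disj_un_two(3))
    then have "B M (Suc K) = B M K + (\<Sum>n\<in>A \<inter> {2 ^ K * M..<2 ^ Suc K * M}. real n powr (- s))"
      unfolding B_def by (subst sum.union_disjoint[symmetric]) auto
    with Suc block[OF M, of K] show ?case by (simp add: algebra_simps)
  qed (simp add: B_def)
  define C' where "C' = C * 2 powr \<alpha> / (1 - q)"
  have "(\<Sum>n\<in>F. real n powr (- s)) \<le> C' * real M powr (\<alpha> - s)"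
    if M: "M \<ge> 1" and F: "finite F" "F \<subseteq> A \<inter> {M..}" for M F
  proof -
    \<comment> \<open>A crude number of blocks is enough, since the geometric sum is bounded
      independently of it.\<close>
    have "n < 2 ^ (Max F + 1) * M" if "n \<in> F" for n
    proof -
      have "n \<le> Max F" using that F(1) by simp
      also have "\<dots> < 2 ^ Max F" by simp
      also have "\<dots> \<le> 2 ^ (Max F + 1) * M" using M by simp
      finally show ?thesis .
    qed
    then have "F \<subseteq> A \<inter> {M..<2 ^ (Max F + 1) * M}" using F by auto
    then have "(\<Sum>n\<in>F. real n powr (- s)) \<le> B M (Max F + 1)"
      unfolding B_def by (intro sum_mono2) auto
    also have "\<dots> \<le> C * 2 powr \<alpha> * real M powr (\<alpha> - s) * (\<Sum>k<Max F + 1. q ^ k)"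
      by (rule B[OF M])
    also have "\<dots> \<le> C * 2 powr \<alpha> * real M powr (\<alpha> - s) * (1 / (1 - q))"
      using q C by (intro mult_left_mono) (auto simp: sum_gp_strict divide_right_mono simp del: sum.lessThan_Suc)
    finally show ?thesis by (simp add: C'_def mult_ac)
  qed
  moreover have "C' \<ge> 0" using C q by (simp add: C'_def)
  ultimately show ?thesis by blast
qed

text \<open>
  Peeling off the factor \<open>a\<^sup>k\<close> costs a factor \<open>\<Sum> b\<^bsup>-1/k\<^esup>\<close> over the remaining cofactors \<open>b\<close>, and
  this converges because their counting function is \<open>O(N\<^bsup>1/(k+1)\<^esup>)\<close>.
\<close>

lemma card_power_products:
  assumes "k > 0"
  shows "\<exists>C. \<forall>N. real (card (power_products k m \<inter> {1..N})) \<le> C * real N powr (1 / real k)"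
  using assms
proof (induction m arbitrary: k)
  case 0
  \<comment> \<open>For \<open>N = 0\<close> both sides are 0, as
    \<open>0 powr x = 0\<close>.\<close>
  have "real (card ({1::nat} \<inter> {1..N})) \<le> 1 * real N powr (1 / real k)" for N
    by (cases "N = 0") (auto simp: ge_one_powr_ge_zero)
  then show ?case by (intro exI[of _ 1]) simp
next
  case (Suc m)
  define B where "B = power_products (Suc k) m"
  obtain C where C: "\<And>N. real (card (B \<inter> {1..N})) \<le> C * real N powr (1 / real (Suc k))"
    using Suc.IH[of "Suc k"] unfolding B_def by auto
  have "1 / real (Suc k) < 1 / real k" "1 / real k > 0" using Suc.prems by (auto simp: field_simps)
  \<comment> \<open>The exponents are 1/(k+1) and 1/k; at \<open>M = 1\<close> the power of
    \<open>M\<close> is 1, so the bound is a constant.\<close>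
  from dyadic_tail_bound[OF C this]
  obtain C' where C': "\<And>F. finite F \<Longrightarrow> F \<subseteq> B \<inter> {1..} \<Longrightarrow> (\<Sum>n\<in>F. real n powr (- (1 / real k))) \<le> C'"
    by fastforce
  have "real (card (power_products k (Suc m) \<inter> {1..N})) \<le> C' * real N powr (1 / real k)" for N
  proof -
    \<comment> \<open>For \<open>b > 0\<close> this is the largest \<open>a\<close> with
      \<open>a ^ k * b \<le> N\<close>. A number may have several such representations, so the pairs
      give an upper bound for the count.\<close>
    define R where "R b = nat \<lfloor>(real N / real b) powr (1 / real k)\<rfloor>" for b :: nat
    have "power_products k (Suc m) \<inter> {1..N}
            \<subseteq> (\<lambda>(b, a). a ^ k * b) ` (SIGMA b:B \<inter> {1..N}. {1..R b})"
    proof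
      fix n assume "n \<in> power_products k (Suc m) \<inter> {1..N}"
      then obtain a b where n: "n = a ^ k * b" "a > 0" "b \<in> B" "n \<le> N" by (auto simp: B_def)
      have b: "b > 0" using power_products_pos n(3) B_def by blast
      have "b \<le> N" using n by (metis le_trans mult_le_mono1 nat_mult_1 Suc_leI zero_less_power One_nat_def)
      have "real (a ^ k * b) \<le> real N" using n by (simp only: of_nat_le_iff)
      then have "real a ^ k \<le> real N / real b"
        using b by (simp add: field_simps)
      then have "(real a ^ k) powr (1 / real k) \<le> (real N / real b) powr (1 / real k)"
        by (intro powr_mono2) auto
      also have "(real a ^ k) powr (1 / real k) = real a"
        using Suc.prems n(2) by (simp add: powr_powr flip: powr_realpow)
      finally have "a \<le> R b" unfolding R_def by (simp add: le_nat_floor)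
      then show "n \<in> (\<lambda>(b, a). a ^ k * b) ` (SIGMA b:B \<inter> {1..N}. {1..R b})"
        using n b \<open>b \<le> N\<close> by (intro image_eqI[of _ _ "(b, a)"]) auto
    qed
    then have "card (power_products k (Suc m) \<inter> {1..N}) \<le> card (SIGMA b:B \<inter> {1..N}. {1..R b})"
      by (rule surj_card_le[rotated]) auto
    also have "\<dots> = (\<Sum>b\<in>B \<inter> {1..N}. R b)" by simp
    finally have "real (card (power_products k (Suc m) \<inter> {1..N})) \<le> (\<Sum>b\<in>B \<inter> {1..N}. real (R b))"
      by (metis of_nat_le_iff of_nat_sum)
    also have "\<dots> \<le> (\<Sum>b\<in>B \<inter> {1..N}. real N powr (1 / real k) * real b powr (- (1 / real k)))"
    proof (rule sum_mono)
      fix b assume "b \<in> B \<inter> {1..N}"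
      have "real (R b) \<le> (real N / real b) powr (1 / real k)" unfolding R_def by simp
      then show "real (R b) \<le> real N powr (1 / real k) * real b powr (- (1 / real k))"
        by (simp add: powr_divide powr_minus_divide)
    qed
    also have "\<dots> = real N powr (1 / real k) * (\<Sum>b\<in>B \<inter> {1..N}. real b powr (- (1 / real k)))"
      by (simp add: sum_distrib_left)
    also have "\<dots> \<le> real N powr (1 / real k) * C'"
      by (intro mult_left_mono C') auto
    finally show ?thesis by (simp add: mult.commute)
  qed
  then show ?case by blast
qed

section \<open>Summatory functions and the Euler product\<close>

lemma sum_sum_divisors:
  fixes g :: "nat \<Rightarrow> real"
  shows "(\<Sum>n=1..N. \<Sum>d | d dvd n. g d) = (\<Sum>d=1..N. g d * real (N div d))"
proof -
  have "(\<Sum>n=1..N. \<Sum>d | d dvd n. g d) = (\<Sum>n=1..N. \<Sum>d=1..N. if d dvd n then g d else 0)"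
  proof (rule sum.cong[OF refl])
    fix n assume "n \<in> {1..N}"
    then have "{d. d dvd n} = {d \<in> {1..N}. d dvd n}"
      by (auto dest: dvd_imp_le dvd_pos_nat)
    then show "(\<Sum>d | d dvd n. g d) = (\<Sum>d=1..N. if d dvd n then g d else 0)"
      by (simp only: sum.inter_filter[symmetric] finite_atLeastAtMost)
  qed
  also have "\<dots> = (\<Sum>d=1..N. \<Sum>n=1..N. if d dvd n then g d else 0)"
    by (rule sum.swap)
  also have "\<dots> = (\<Sum>d=1..N. g d * real (N div d))"
  proof (rule sum.cong[OF refl])
    fix d assume d: "d \<in> {1..N}"
    have "{n \<in> {1..N}. d dvd n} = (\<lambda>k. d * k) ` {1..N div d}"
      using d by (force simp: dvd_def less_eq_div_iff_mult_less_eq mult.commute)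
    then have "card {n \<in> {1..N}. d dvd n} = N div d"
      using d by (simp add: card_image inj_on_def)
    moreover have "(\<Sum>n=1..N. if d dvd n then g d else 0) = real (card {n \<in> {1..N}. d dvd n}) * g d"
      by (simp add: sum.If_cases Int_def)
    ultimately show "(\<Sum>n=1..N. if d dvd n then g d else 0) = g d * real (N div d)"
      by simp
  qed
  finally show ?thesis .
qed

lemma sum_indicator_real:
  "finite A \<Longrightarrow> (\<Sum>n\<in>A. indicator B n) = real (card (B \<inter> A))"
  by (simp add: indicator_def sum.If_cases Int_commute)

text \<open>The first claim feeds the Euler product, the second compares its partial products with
  the full sum, and the third counts \<open>S\<close>. All rest on the tail bound with s =
  1.\<close>

lemma sparse_convolution:
  fixes g :: "nat \<Rightarrow> real" and T :: "nat set" and C \<alpha> :: real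
  assumes card: "\<And>N. real (card (T \<inter> {1..N})) \<le> C * real N powr \<alpha>"
    and \<alpha>: "\<alpha> < 1"
    and g: "\<And>n. n > 0 \<Longrightarrow> \<bar>g n\<bar> \<le> indicator T n"
  shows "(\<lambda>n. norm (g n / real n)) summable_on UNIV"
    and "\<exists>C'. \<forall>N\<ge>1. \<forall>X\<subseteq>{N..}. \<bar>\<Sum>\<^sub>\<infinity>n\<in>X. g n / real n\<bar> \<le> C' * real N powr (\<alpha> - 1)"
    and "\<exists>C'. \<forall>N\<ge>1. \<bar>(\<Sum>n=1..N. \<Sum>d | d dvd n. g d) - real N * (\<Sum>\<^sub>\<infinity>n. g n / real n)\<bar>
                 \<le> C' * real N powr \<alpha>"
proof -
  let ?f = "\<lambda>n. g n / real n"
  obtain C' where C': "C' \<ge> 0" and tail: "\<And>M F. M \<ge> 1 \<Longrightarrow> finite F \<Longrightarrow> F \<subseteq> T \<inter> {M..} \<Longrightarrow>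
           (\<Sum>n\<in>F. real n powr (- 1)) \<le> C' * real M powr (\<alpha> - 1)"
    using dyadic_tail_bound[OF card \<alpha>] by auto
  have fin: "(\<Sum>n\<in>F. \<bar>?f n\<bar>) \<le> C' * real M powr (\<alpha> - 1)" if "M \<ge> 1" "finite F" "F \<subseteq> {M..}" for M F
  proof -
    have "(\<Sum>n\<in>F. \<bar>?f n\<bar>) \<le> (\<Sum>n\<in>F. if n \<in> T then real n powr (- 1) else 0)"
    proof (rule sum_mono)
      fix n assume "n \<in> F"
      then have n: "n > 0" using that by fastforce
      then show "\<bar>?f n\<bar> \<le> (if n \<in> T then real n powr (- 1) else 0)"
        using g[OF n] by (auto simp: powr_minus divide_simps indicator_def split: if_splits)
    qed
    also have "\<dots> = (\<Sum>n\<in>F \<inter> T. real n powr (- 1))"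
      using that by (simp add: sum.If_cases)
    also have "\<dots> \<le> C' * real M powr (\<alpha> - 1)"
      using that by (intro tail) auto
    finally show ?thesis .
  qed
  show summ: "(\<lambda>n. norm (?f n)) summable_on UNIV"
  proof (rule nonneg_bdd_above_summable_on)
    show "bdd_above (sum (\<lambda>x. norm (?f x)) ` {F. F \<subseteq> UNIV \<and> finite F})"
    proof (rule bdd_aboveI2)
      fix F :: "nat set" assume "F \<in> {F. F \<subseteq> UNIV \<and> finite F}"
      then have F: "finite F" by simp
      \<comment> \<open>The term at 0 is 0 because division by 0 yields 0; \<open>g\<close> is
        bounded only at positive arguments.\<close>
      have "(\<Sum>n\<in>F. norm (?f n)) = (\<Sum>n\<in>F - {0}. \<bar>?f n\<bar>)"
        using F by (intro sum.mono_neutral_cong_right) auto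
      also have "\<dots> \<le> C' * real 1 powr (\<alpha> - 1)"
        using F by (intro fin) auto
      finally show "(\<Sum>n\<in>F. norm (?f n)) \<le> C'" by simp
    qed
  qed simp
  have summX: "(\<lambda>n. norm (?f n)) summable_on X" for X
    by (rule summable_on_subset_banach[OF summ]) simp
  have summX': "?f summable_on X" for X
    using summX summable_on_iff_abs_summable_on_real by blast
  have tl: "\<bar>\<Sum>\<^sub>\<infinity>n\<in>X. ?f n\<bar> \<le> C' * real N powr (\<alpha> - 1)" if "N \<ge> 1" "X \<subseteq> {N..}" for N X
  proof -
    have "\<bar>\<Sum>\<^sub>\<infinity>n\<in>X. ?f n\<bar> \<le> (\<Sum>\<^sub>\<infinity>n\<in>X. \<bar>?f n\<bar>)"
      using norm_infsum_bound[OF summX[of X]] by simp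
    also have "\<dots> \<le> C' * real N powr (\<alpha> - 1)"
      using that summX[of X] by (intro infsum_le_finite_sums fin) auto
    finally show ?thesis .
  qed
  then show "\<exists>C'. \<forall>N\<ge>1. \<forall>X\<subseteq>{N..}. \<bar>\<Sum>\<^sub>\<infinity>n\<in>X. ?f n\<bar> \<le> C' * real N powr (\<alpha> - 1)"
    by blast
  \<comment> \<open>\<open>C\<close> pays for rounding \<open>N / d\<close> down to
    \<open>N div d\<close>, an error of at most 1 for each \<open>d\<close> in \<open>T\<close>;
    \<open>C'\<close> pays for the tail beyond \<open>N\<close>.\<close>
  have "\<bar>(\<Sum>n=1..N. \<Sum>d | d dvd n. g d) - real N * (\<Sum>\<^sub>\<infinity>n. ?f n)\<bar> \<le> (C + C') * real N powr \<alpha>"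
    if N: "N \<ge> 1" for N
  proof -
    have "(\<Sum>\<^sub>\<infinity>n. ?f n) = (\<Sum>\<^sub>\<infinity>n\<in>{..N} \<union> {N<..}. ?f n)"
      by (rule arg_cong[of _ _ "infsum _"]) auto
    also have "\<dots> = (\<Sum>\<^sub>\<infinity>n\<in>{..N}. ?f n) + (\<Sum>\<^sub>\<infinity>n\<in>{N<..}. ?f n)"
      by (intro infsum_Un_disjoint summX') auto
    also have "(\<Sum>\<^sub>\<infinity>n\<in>{..N}. ?f n) = (\<Sum>n=1..N. ?f n)"
      by (simp, intro sum.mono_neutral_right) auto
    finally have D: "(\<Sum>\<^sub>\<infinity>n. ?f n) = (\<Sum>n=1..N. ?f n) + (\<Sum>\<^sub>\<infinity>n\<in>{N<..}. ?f n)" .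
    have "\<bar>(\<Sum>d=1..N. g d * real (N div d)) - (\<Sum>d=1..N. real N * ?f d)\<bar>
            \<le> (\<Sum>d=1..N. \<bar>g d * real (N div d) - real N * ?f d\<bar>)"
      unfolding sum_subtractf[symmetric] by (rule sum_abs)
    also have "\<dots> \<le> (\<Sum>d=1..N. indicator T d)"
    proof (rule sum_mono)
      fix d assume d: "d \<in> {1..N}"
      have "real N / real d - 1 \<le> real (N div d)" "real (N div d) \<le> real N / real d"
        using real_of_int_div3[of "int N" "int d"] of_nat_div_le_of_nat[of N d]
        by (simp_all flip: zdiv_int)
      then have "\<bar>real (N div d) - real N / real d\<bar> \<le> 1" by linarith
      moreover have "g d * real (N div d) - real N * ?f d = g d * (real (N div d) - real N / real d)"
        by (simp add: algebra_simps)
      ultimately have "\<bar>g d * real (N div d) - real N * ?f d\<bar> \<le> \<bar>g d\<bar>"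
        by (simp add: abs_mult mult_left_le)
      then show "\<bar>g d * real (N div d) - real N * ?f d\<bar> \<le> indicator T d"
        using g[of d] d by simp
    qed
    also have "\<dots> = real (card (T \<inter> {1..N}))"
      by (simp add: sum_indicator_real)
    also have "\<dots> \<le> C * real N powr \<alpha>" by (rule card)
    finally have 1: "\<bar>(\<Sum>d=1..N. g d * real (N div d)) - real N * (\<Sum>d=1..N. ?f d)\<bar> \<le> C * real N powr \<alpha>"
      by (simp only: sum_distrib_left)
    have "\<bar>\<Sum>\<^sub>\<infinity>n\<in>{N<..}. ?f n\<bar> \<le> C' * real N powr (\<alpha> - 1)"
      by (rule tl[OF N]) auto
    then have "\<bar>real N * (\<Sum>\<^sub>\<infinity>n\<in>{N<..}. ?f n)\<bar> \<le> real N * (C' * real N powr (\<alpha> - 1))"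
      by (simp add: abs_mult mult_left_mono)
    also have "\<dots> = C' * real N powr \<alpha>"
      using N by (simp add: powr_diff)
    finally show ?thesis
      using 1 unfolding D sum_sum_divisors by (simp add: algebra_simps)
  qed
  then show "\<exists>C'. \<forall>N\<ge>1. \<bar>(\<Sum>n=1..N. \<Sum>d | d dvd n. g d) - real N * (\<Sum>\<^sub>\<infinity>n. ?f n)\<bar>
                 \<le> C' * real N powr \<alpha>"
    by blast
qed

section \<open>Euler products over finite sets of primes\<close>

lemma smooth_insert_prime:
  fixes p :: nat
  assumes p: "prime p" and pP: "p \<notin> P"
  shows "{n. n > 0 \<and> prime_factors n \<subseteq> insert p P}
       = (\<lambda>(d, a). d * p ^ a) ` ({n. n > 0 \<and> prime_factors n \<subseteq> P} \<times> UNIV)" (is "?L = ?R")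
proof (intro equalityI subsetI)
  fix n assume n: "n \<in> ?L"
  then obtain m where m: "n = p ^ multiplicity p n * m" "\<not> p dvd m"
    using multiplicity_decompose'[of n p] p by (metis mem_Collect_eq not_gr_zero not_prime_unit)
  have m0: "m > 0" using m(2) by (auto intro: Nat.gr0I)
  have "prime_factors m \<subseteq> P"
  proof
    fix q assume q: "q \<in> prime_factors m"
    then have "q \<noteq> p" using m(2) by auto
    moreover have "q dvd n" using q m(1) by (metis dvd_mult in_prime_factors_imp_dvd)
    then have "q \<in> prime_factors n" using n q by (auto simp: prime_factors_dvd)
    ultimately show "q \<in> P" using n by auto
  qed
  then show "n \<in> ?R"
    using m0 m(1) by (intro image_eqI[of _ _ "(m, multiplicity p n)"]) (auto simp: mult.commute)
next
  fix n assume "n \<in> ?R"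
  then obtain d a where d: "n = d * p ^ a" "d > 0" "prime_factors d \<subseteq> P" by auto
  have "prime_factors n \<subseteq> insert p P"
  proof
    fix q assume "q \<in> prime_factors n"
    then have q: "prime q" "q dvd d * p ^ a" using d by auto
    then have "q dvd d \<or> q dvd p" using prime_dvd_mult_iff prime_dvd_power by blast
    then show "q \<in> insert p P"
      using d q(1) p primes_dvd_imp_eq by (auto simp: prime_factors_dvd)
  qed
  then show "n \<in> ?L" using d p by (auto simp: prime_gt_0_nat)
qed

text \<open>Each number built from \<open>insert p P\<close> is uniquely \<open>d * p ^ a\<close>
  with \<open>d\<close> built from \<open>P\<close>, so the sum over pairs factors. Absolute
  convergence over all \<open>n\<close> permits the iterated summation.\<close>

lemma finite_euler_product:
  fixes P :: "nat set"
  assumes summ: "(\<lambda>n. norm (multiplicative_ext w n / real n)) summable_on UNIV"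
    and w: "\<And>p. w p 0 = 1"
    and P: "finite P" "\<And>p. p \<in> P \<Longrightarrow> prime p"
  shows "(\<Sum>\<^sub>\<infinity>n | n > 0 \<and> prime_factors n \<subseteq> P. multiplicative_ext w n / real n)
           = (\<Prod>p\<in>P. \<Sum>\<^sub>\<infinity>a. w p a / real p ^ a)"
  using P
proof (induction P rule: finite_induct)
  case empty
  have "{n::nat. n > 0 \<and> prime_factors n \<subseteq> {}} = {1}"
  proof (intro equalityI subsetI)
    fix n :: nat assume "n \<in> {n. n > 0 \<and> prime_factors n \<subseteq> {}}"
    then have "n > 0" "\<not> (\<exists>p. prime p \<and> p dvd n)"
      using prime_factors_dvd[of n] by auto
    then show "n \<in> {1}" using prime_factor_nat by blast
  qed simp
  then show ?case by simp
next
  case (insert p P)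
  let ?f = "\<lambda>n. multiplicative_ext w n / real n"
  let ?A = "{n. n > 0 \<and> prime_factors n \<subseteq> P}"
  have p: "prime p" using insert.prems by simp
  have pd: "\<not> p dvd d" if "d \<in> ?A" for d
  proof
    assume "p dvd d"
    then have "p \<in> prime_factors d" using that p by (simp add: prime_factors_dvd)
    then show False using that insert.hyps(2) by blast
  qed
  have bij: "bij_betw (\<lambda>(d, a). d * p ^ a) (?A \<times> UNIV) {n. n > 0 \<and> prime_factors n \<subseteq> insert p P}"
    unfolding bij_betw_def
    by (intro conjI inj_on_times_prime_power[OF p] pd smooth_insert_prime[OF p insert.hyps(2), symmetric])
  have f_mult: "?f (case x of (d, a) \<Rightarrow> d * p ^ a) = (case x of (d, a) \<Rightarrow> ?f d * (w p a / real p ^ a))"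
    if "x \<in> ?A \<times> UNIV" for x
  proof -
    obtain d a where x: "x = (d, a)" "d \<in> ?A" using \<open>x \<in> ?A \<times> UNIV\<close> by blast
    have "multiplicative_ext w (d * p ^ a) = multiplicative_ext w d * w p a"
      using multiplicative_ext_mult_prime_power[of p d w a] p pd[OF x(2)] w x(2) by blast
    then show ?thesis by (simp add: x(1))
  qed
  have "?f summable_on {n. n > 0 \<and> prime_factors n \<subseteq> insert p P}"
    by (rule summable_on_subset_banach[OF summable_on_iff_abs_summable_on_real[THEN iffD2, OF summ]]) simp
  then have "(\<lambda>x. ?f (case x of (d, a) \<Rightarrow> d * p ^ a)) summable_on (?A \<times> UNIV)"
    by (rule summable_on_reindex_bij_betw[OF bij, THEN iffD2])
  then have summ2: "(\<lambda>(d, a). ?f d * (w p a / real p ^ a)) summable_on (?A \<times> UNIV)"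
    by (simp only: summable_on_cong[OF f_mult])
  have "(\<Sum>\<^sub>\<infinity>n | n > 0 \<and> prime_factors n \<subseteq> insert p P. ?f n)
          = (\<Sum>\<^sub>\<infinity>x\<in>?A \<times> UNIV. ?f (case x of (d, a) \<Rightarrow> d * p ^ a))"
    by (rule infsum_reindex_bij_betw[OF bij, symmetric])
  also have "\<dots> = (\<Sum>\<^sub>\<infinity>(d, a)\<in>?A \<times> UNIV. ?f d * (w p a / real p ^ a))"
    by (rule infsum_cong[OF f_mult])
  also have "\<dots> = (\<Sum>\<^sub>\<infinity>d\<in>?A. \<Sum>\<^sub>\<infinity>a. ?f d * (w p a / real p ^ a))"
    by (rule infsum_Sigma'_banach[symmetric]) (rule summ2)
  also have "\<dots> = (\<Sum>\<^sub>\<infinity>d\<in>?A. ?f d) * (\<Sum>\<^sub>\<infinity>a. w p a / real p ^ a)"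
    unfolding infsum_cmult_right' by (rule infsum_cmult_left')
  also have "\<dots> = (\<Prod>p\<in>insert p P. \<Sum>\<^sub>\<infinity>a. w p a / real p ^ a)"
  proof -
    have "(\<Sum>\<^sub>\<infinity>d\<in>?A. ?f d) = (\<Prod>p\<in>P. \<Sum>\<^sub>\<infinity>a. w p a / real p ^ a)"
      by (rule insert.IH) (use insert.prems in blast)
    then show ?thesis
      by (simp only: prod.insert[OF insert.hyps(1,2)] mult.commute)
  qed
  finally show ?case .
qed

text \<open>With x = 1/p, shifting the index multiplies the series of \<open>\<rho>\<close> by x, so
  the series of differences is (1 - x) times that of \<open>\<rho>\<close>. The leading 1 in the
  bracket is the term at exponent 0.\<close>

lemma sum_prime_powers_diff:
  fixes \<rho> :: "nat \<Rightarrow> real" and p :: nat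
  assumes p: "p \<ge> 2" and \<rho>: "\<rho> 0 = 1" "\<And>a. \<rho> a \<in> {0, 1}"
  shows "(\<Sum>\<^sub>\<infinity>a. (if a = 0 then 1 else \<rho> a - \<rho> (a - 1)) / real p ^ a)
       = (1 - 1 / real p) * (1 + (\<Sum>\<^sub>\<infinity>a\<in>{a. a \<ge> 1 \<and> \<rho> a = 1}. 1 / real p ^ a))"
proof -
  let ?g = "\<lambda>a. (1 / real p) ^ a"
  let ?h = "\<lambda>a. if a = 0 then 1 else \<rho> a - \<rho> (a - 1)"
  let ?R = "\<lambda>a. \<rho> a / real p ^ a"
  have "summable ?g" using p by (intro summable_geometric) (simp add: field_simps)
  then have gs: "?g summable_on UNIV"
    by (intro norm_summable_imp_summable_on) simp
  have Rsum: "?R summable_on X" for X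
  proof (rule summable_on_subset_banach)
    show "?R summable_on UNIV"
    proof (rule summable_on_comparison_test[OF gs])
      fix a show "?R a \<le> ?g a" "0 \<le> ?R a"
        using \<rho>(2)[of a] by (auto simp: power_one_over)
    qed
  qed simp
  have tail: "(\<Sum>\<^sub>\<infinity>a\<in>{a. a \<ge> 1 \<and> \<rho> a = 1}. 1 / real p ^ a) = infsum ?R {1..}"
    using \<rho>(2) by (intro infsum_cong_neutral) auto
  have UN: "(UNIV :: nat set) = insert 0 {1..}" by auto
  have R: "infsum ?R UNIV = 1 + infsum ?R {1..}"
    unfolding UN by (subst infsum_insert) (auto simp: Rsum \<rho>)
  have bij: "bij_betw Suc UNIV {1..}"
    by (rule bij_betwI[of _ _ _ "\<lambda>n. n - 1"]) auto
  have step: "\<rho> (Suc a - 1) / real p ^ Suc a = ?R a * (1 / real p)" for a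
    by simp
  have shift: "infsum (\<lambda>a. \<rho> (a - 1) / real p ^ a) {1..} = infsum ?R UNIV / real p"
    unfolding infsum_reindex_bij_betw[OF bij, symmetric] step infsum_cmult_left' by simp
  have shifts: "(\<lambda>a. \<rho> (a - 1) / real p ^ a) summable_on {1..}"
    unfolding summable_on_reindex_bij_betw[OF bij, symmetric] step
    by (intro summable_on_cmult_left Rsum)
  have hcong: "?h a / real p ^ a = ?R a + - (\<rho> (a - 1) / real p ^ a)" if "a \<in> {1..}" for a
    using that by (simp add: diff_divide_distrib)
  have "(\<lambda>a. ?R a + - (\<rho> (a - 1) / real p ^ a)) summable_on {1..}"
    by (intro summable_on_add Rsum summable_on_uminus[THEN iffD2] shifts)
  then have hs: "(\<lambda>a. ?h a / real p ^ a) summable_on {1..}"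
    by (subst summable_on_cong[OF hcong])
  have "infsum (\<lambda>a. ?h a / real p ^ a) UNIV = 1 + infsum (\<lambda>a. ?h a / real p ^ a) {1..}"
    unfolding UN using hs by (subst infsum_insert) auto
  also have "infsum (\<lambda>a. ?h a / real p ^ a) {1..} = infsum (\<lambda>a. ?R a + - (\<rho> (a - 1) / real p ^ a)) {1..}"
    by (rule infsum_cong[OF hcong])
  also have "\<dots> = infsum ?R {1..} - infsum ?R UNIV / real p"
    using Rsum shifts shift by (subst infsum_add) (auto simp: summable_on_uminus infsum_uminus)
  finally show ?thesis
    unfolding tail R by (simp add: algebra_simps diff_divide_distrib add_divide_distrib)
qed

section \<open>Convergence of the density product\<close>

lemma density_factor_bounds:
  assumes p: "p \<ge> 2" and S: "p \<in> S"
  shows "\<bar>density_factor S p - 1\<bar> \<le> 1 / real p ^ 2"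
proof -
  let ?g = "\<lambda>a. 1 / real p ^ a"
  let ?E = "{a. a \<ge> 1 \<and> p ^ a \<in> S}"
  have "(\<lambda>n. (1 / real p) ^ n) sums (1 / (1 - 1 / real p))"
    using p by (intro geometric_sums) (simp add: field_simps)
  then have "(?g has_sum (1 / (1 - 1 / real p))) UNIV"
    by (intro norm_summable_imp_has_sum) (auto simp: power_one_over sums_iff)
  then have gs: "?g summable_on UNIV" and gi: "infsum ?g UNIV = 1 / (1 - 1 / real p)"
    by (auto simp: has_sum_imp_summable infsumI)
  have gX: "?g summable_on X" for X
    using gs by (rule summable_on_subset_banach) simp
  \<comment> \<open>Exponent 1 alone gives the lower bound (1 - 1/p)(1 + 1/p) = 1 - 1/p^2; the full
    geometric series gives the upper bound 1.\<close>
  have "infsum ?g {1} \<le> infsum ?g ?E"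
    using S by (intro infsum_mono_neutral gX) auto
  then have lo: "1 / real p \<le> infsum ?g ?E" by simp
  have "1 + infsum ?g ?E = infsum ?g (insert 0 ?E)"
    by (subst infsum_insert) (auto simp: gX)
  also have "\<dots> \<le> infsum ?g UNIV"
    by (intro infsum_mono_neutral gX) auto
  finally have hi: "1 + infsum ?g ?E \<le> 1 / (1 - 1 / real p)" by (simp add: gi)
  have p1: "1 - 1 / real p > 0" using p by (simp add: field_simps)
  have "density_factor S p \<le> (1 - 1 / real p) * (1 / (1 - 1 / real p))"
    unfolding density_factor_def using hi p1 by (intro mult_left_mono) auto
  also have "\<dots> = 1" using p1 by (metis less_irrefl nonzero_mult_div_cancel_left times_divide_eq_right mult.right_neutral)
  finally have "density_factor S p \<le> 1" .
  moreover have "(1 - 1 / real p) * (1 + 1 / real p) \<le> density_factor S p"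
    unfolding density_factor_def using lo p1 by (intro mult_left_mono) auto
  moreover have "(1 - 1 / real p) * (1 + 1 / real p) = 1 - 1 / real p ^ 2"
    by (simp add: algebra_simps power2_eq_square)
  ultimately show ?thesis by (simp add: abs_le_iff)
qed

lemma convergent_prod_prime_density_factor:
  assumes "\<And>p. prime p \<Longrightarrow> p \<in> S"
  shows "convergent_prod (prime_density_factor S)"
proof -
  have summ: "summable (\<lambda>n. 1 / real n ^ 2)"
    using inverse_power_summable[of 2, where ?'a = real] by (simp add: divide_inverse)
  have bound: "norm (norm (prime_density_factor S n - 1)) \<le> 1 / real n ^ 2" for n
  proof (cases "prime n")
    case True
    then show ?thesis
      using density_factor_bounds[OF prime_ge_2_nat[OF True] assms[OF True]]
      by (simp add: prime_density_factor_def)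
  qed (simp add: prime_density_factor_def)
  have "summable (\<lambda>n. norm (prime_density_factor S n - 1))"
    by (rule summable_comparison_test'[OF summ, of 0]) (rule bound)
  then show ?thesis
    by (intro abs_convergent_prod_imp_convergent_prod summable_imp_abs_convergent_prod)
qed

section \<open>Asymptotic formula and density of \<open>S\<close>\<close>

theorem theorem2p5:
  fixes r :: nat and S :: "nat set"
  assumes "r \<ge> 2"
    and "multiplicative_set S"
    and "\<And>p. prime p \<Longrightarrow> first_missing_exponent S p \<ge> enat r"
  shows "convergent_prod (prime_density_factor S) \<and>
         has_asymptotic_density S (density_product S) \<and>
         (\<lambda>x::real. (\<Sum>n | 1 \<le> n \<and> real n \<le> x. indicator S n) - density_product S * x)
           \<in> O(\<lambda>x. x powr (1 / real r))"
proof -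
  have S: "S \<subseteq> {1..}" "1 \<in> S" and mult: "multiplicative_fun (indicator S :: nat \<Rightarrow> real)"
    using assms(2) by (auto simp: multiplicative_set_def)
  \<comment> \<open>Exponent 0 is included, so that for 0 < a < r both \<open>p ^ a\<close> and
    \<open>p ^ (a - 1)\<close> lie in \<open>S\<close> and their difference vanishes.\<close>
  have low: "p ^ a \<in> S" if "prime p" "a < r" for p a
  proof (rule ccontr)
    assume "p ^ a \<notin> S"
    then have a: "a \<in> {a. a \<ge> 1 \<and> p ^ a \<notin> S}"
      using S(2) by (cases "a = 0") auto
    have "first_missing_exponent S p \<le> enat a"
      unfolding first_missing_exponent_def by (rule INF_lower[OF a])
    then have "enat r \<le> enat a" using assms(3)[OF that(1)] by (rule order_trans[rotated])
    then show False using that(2) by simp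
  qed
  have conv: "convergent_prod (prime_density_factor S)"
    using low[where a = 1] assms(1) by (intro convergent_prod_prime_density_factor) simp

  define \<rho> where "\<rho> p a = (indicator S (p ^ a) :: real)" for p a
  \<comment> \<open>At \<open>a = 0\<close> truncated subtraction would make the difference 0, hence
    the separate value 1.\<close>
  define w where "w p a = (if a = 0 then 1 else \<rho> p a - \<rho> p (a - 1))" for p a
  define g where "g = multiplicative_ext w"
  define \<alpha> where "\<alpha> = 1 / real r"
  have \<alpha>: "0 < \<alpha>" "\<alpha> < 1" using assms(1) by (auto simp: \<alpha>_def)
  have w0: "w p 0 = 1" for p by (simp add: w_def)
  have \<rho>0: "\<rho> p 0 = 1" for p using S(2) by (simp add: \<rho>_def)
  have \<rho>01: "\<rho> p a \<in> {0, 1}" for p a by (simp add: \<rho>_def indicator_def)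
  have telescope: "(\<Sum>b\<le>a. w p b) = \<rho> p a" for p a
    by (induction a) (auto simp: w_def \<rho>0)
  have ind: "(\<Sum>d | d dvd n. g d) = indicator S n" if "n > 0" for n
    using sum_divisors_multiplicative_ext[of n w] that w0 multiplicative_ext_prime_powers[OF mult that]
    by (simp add: g_def telescope \<rho>_def)
  have gb: "\<bar>g n\<bar> \<le> indicator (power_products r r) n" if "n > 0" for n
    unfolding g_def
  proof (rule multiplicative_ext_bound)
    show "\<bar>w p a\<bar> \<le> 1" for p a
      using \<rho>01[of p a] \<rho>01[of p "a - 1"] by (auto simp: w_def)
    show "w p a = 0" if "prime p" "0 < a" "a < r" for p a
      using that low by (simp add: w_def \<rho>_def)
  qed (use that assms(1) in auto)
  obtain C where C: "\<And>N. real (card (power_products r r \<inter> {1..N})) \<le> C * real N powr \<alpha>"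
    using card_power_products[of r r] assms(1) unfolding \<alpha>_def by auto
  define D where "D = (\<Sum>\<^sub>\<infinity>n. g n / real n)"
  note conv_g = sparse_convolution[of "power_products r r" C \<alpha> g, OF C \<alpha>(2) gb]
  obtain C1 where C1: "\<And>N X. N \<ge> 1 \<Longrightarrow> X \<subseteq> {N..} \<Longrightarrow> \<bar>\<Sum>\<^sub>\<infinity>n\<in>X. g n / real n\<bar> \<le> C1 * real N powr (\<alpha> - 1)"
    using conv_g(2) by blast
  obtain C2 where C2: "\<And>N. N \<ge> 1 \<Longrightarrow>
      \<bar>(\<Sum>n=1..N. \<Sum>d | d dvd n. g d) - real N * D\<bar> \<le> C2 * real N powr \<alpha>"
    using conv_g(3) unfolding D_def by blast
  have main: "\<bar>real (card (S \<inter> {1..N})) - real N * D\<bar> \<le> C2 * real N powr \<alpha>" if "N \<ge> 1" for N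
  proof -
    have "(\<Sum>n=1..N. \<Sum>d | d dvd n. g d) = (\<Sum>n=1..N. indicator S n)"
      by (intro sum.cong refl ind) auto
    also have "\<dots> = real (card (S \<inter> {1..N}))"
      by (simp add: sum_indicator_real)
    finally show ?thesis using C2[OF that] by simp
  qed
  have decay: "(\<lambda>N. c * real N powr (\<alpha> - 1)) \<longlonglongrightarrow> 0" for c
    using tendsto_mult_right_zero[OF tendsto_neg_powr[OF _ filterlim_real_sequentially, of "\<alpha> - 1"]] \<alpha>(2)
    by simp

  have factor: "density_factor S p = (\<Sum>\<^sub>\<infinity>a. w p a / real p ^ a)" if "prime p" for p
  proof -
    have "{a. a \<ge> 1 \<and> p ^ a \<in> S} = {a. a \<ge> 1 \<and> \<rho> p a = 1}"
      by (auto simp: \<rho>_def indicator_def)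
    then show ?thesis
      unfolding density_factor_def w_def
      using sum_prime_powers_diff[of p "\<rho> p"] prime_ge_2_nat[OF that] \<rho>0 \<rho>01 by simp
  qed
  \<comment> \<open>The partial product is the sum over positive \<open>n\<close> with all prime
    factors at most \<open>N\<close>. Every other positive \<open>n\<close> has a prime factor above
    \<open>N\<close>, so the discrepancy is a tail bounded by \<open>C1\<close>.\<close>
  have partial: "\<bar>(\<Prod>p\<le>N. prime_density_factor S p) - D\<bar> \<le> C1 * real N powr (\<alpha> - 1)"
    if N: "N \<ge> 1" for N
  proof -
    let ?P = "{p. p \<le> N \<and> prime p}"
    let ?A = "{n. n > 0 \<and> prime_factors n \<subseteq> ?P}"
    have "(\<Prod>p\<le>N. prime_density_factor S p) = (\<Prod>p\<in>?P. density_factor S p)"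
      by (intro prod.mono_neutral_cong_right) (auto simp: prime_density_factor_def)
    also have "\<dots> = (\<Prod>p\<in>?P. \<Sum>\<^sub>\<infinity>a. w p a / real p ^ a)"
      by (intro prod.cong refl factor) simp
    also have "\<dots> = (\<Sum>\<^sub>\<infinity>n\<in>?A. g n / real n)"
      unfolding g_def
      by (rule finite_euler_product[symmetric]) (use conv_g(1) w0 in \<open>auto simp: g_def\<close>)
    finally have P: "(\<Prod>p\<le>N. prime_density_factor S p) = (\<Sum>\<^sub>\<infinity>n\<in>?A. g n / real n)" .
    have summ: "(\<lambda>n. g n / real n) summable_on X" for X
      by (rule summable_on_subset_banach[OF summable_on_iff_abs_summable_on_real[THEN iffD2, OF conv_g(1)]]) auto
    have "D = (\<Sum>\<^sub>\<infinity>n\<in>?A \<union> ({0<..} - ?A). g n / real n)"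
      unfolding D_def
    proof (rule infsum_cong_neutral)
      fix n assume "n \<in> UNIV - (?A \<union> ({0<..} - ?A))"
      then have "n \<notin> {0<..}" by blast
      then have "n = 0" by simp
      then show "g n / real n = 0" by simp
    qed simp_all
    also have "\<dots> = (\<Sum>\<^sub>\<infinity>n\<in>?A. g n / real n) + (\<Sum>\<^sub>\<infinity>n\<in>{0<..} - ?A. g n / real n)"
      by (intro infsum_Un_disjoint summ) auto
    finally have "\<bar>(\<Prod>p\<le>N. prime_density_factor S p) - D\<bar> = \<bar>\<Sum>\<^sub>\<infinity>n\<in>{0<..} - ?A. g n / real n\<bar>"
      using P by simp
    also have "\<dots> \<le> C1 * real N powr (\<alpha> - 1)"
    proof (rule C1[OF N], rule subsetI)
      fix n assume n: "n \<in> {0<..} - ?A"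
      then obtain q where "q \<in> prime_factors n" "\<not> q \<le> N" by blast
      then show "n \<in> {N..}" using n dvd_imp_le[of q n] by (auto simp: prime_factors_dvd)
    qed
    finally show ?thesis .
  qed
  have "(\<lambda>N. (\<Prod>p\<le>N. prime_density_factor S p) - D) \<longlonglongrightarrow> 0"
    by (rule Lim_null_comparison[OF _ decay[of C1]])
       (use partial in \<open>auto intro!: eventually_sequentiallyI[of 1]\<close>)
  then have "(\<lambda>N. \<Prod>p\<le>N. prime_density_factor S p) \<longlonglongrightarrow> D"
    by (simp add: LIM_zero_iff)
  with convergent_prod_LIMSEQ[OF conv] have D: "density_product S = D"
    unfolding density_product_def by (rule LIMSEQ_unique)

  have "(\<lambda>N. real (card (S \<inter> {1..N})) / real N - D) \<longlonglongrightarrow> 0"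
  proof (rule Lim_null_comparison[OF _ decay[of C2]], rule eventually_sequentiallyI[of 1])
    fix N :: nat assume N: "N \<ge> 1"
    have "real (card (S \<inter> {1..N})) / real N - D = (real (card (S \<inter> {1..N})) - real N * D) / real N"
      using N by (simp add: diff_divide_distrib)
    then have "\<bar>real (card (S \<inter> {1..N})) / real N - D\<bar> = \<bar>real (card (S \<inter> {1..N})) - real N * D\<bar> / real N"
      by (simp add: abs_divide)
    also have "\<dots> \<le> C2 * real N powr \<alpha> / real N"
      using main[OF N] by (intro divide_right_mono) auto
    finally show "norm (real (card (S \<inter> {1..N})) / real N - D) \<le> C2 * real N powr (\<alpha> - 1)"
      using N by (simp add: powr_diff)
  qed
  then have dens: "has_asymptotic_density S D"
    by (simp add: has_asymptotic_density_def LIM_zero_iff)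

  have "(\<lambda>x::real. (\<Sum>n | 1 \<le> n \<and> real n \<le> x. indicator S n) - D * x) \<in> O(\<lambda>x. x powr \<alpha>)"
  \<comment> \<open>\<open>\<bar>C2\<bar>\<close> bounds the error at the integer part of x;
    \<open>\<bar>D\<bar>\<close> pays for replacing that integer by x, a change below 1 and so at
    most \<open>x powr \<alpha>\<close>.\<close>
  proof (rule bigoI[where c = "\<bar>C2\<bar> + \<bar>D\<bar>"], rule eventually_mono[OF eventually_ge_at_top[of 1]])
    fix x :: real assume x: "x \<ge> 1"
    define N where "N = nat \<lfloor>x\<rfloor>"
    have N: "N \<ge> 1" "real N \<le> x" "x < real N + 1" using x unfolding N_def by linarith+
    have "{n. 1 \<le> n \<and> real n \<le> x} = {1..N}"
    proof -
      have "real n \<le> x \<longleftrightarrow> n \<le> N" for n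
      proof
        assume "real n \<le> x"
        then have "real n < real (N + 1)" using N by simp
        then show "n \<le> N" by (simp only: of_nat_less_iff)
      next
        assume "n \<le> N"
        then have "real n \<le> real N" by simp
        then show "real n \<le> x" using N(2) by (rule order_trans)
      qed
      then show ?thesis
        by (simp only: set_eq_iff mem_Collect_eq atLeastAtMost_iff simp_thms)
    qed
    then have "(\<Sum>n | 1 \<le> n \<and> real n \<le> x. indicator S n) = real (card (S \<inter> {1..N}))"
      by (simp add: sum_indicator_real)
    moreover have "\<bar>real (card (S \<inter> {1..N})) - real N * D\<bar> \<le> \<bar>C2\<bar> * x powr \<alpha>"
    proof -
      have "C2 * real N powr \<alpha> \<le> \<bar>C2\<bar> * x powr \<alpha>"
        using N \<alpha> by (intro mult_mono powr_mono2) auto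
      then show ?thesis using main[OF N(1)] by linarith
    qed
    moreover have "\<bar>real N * D - D * x\<bar> \<le> \<bar>D\<bar> * x powr \<alpha>"
    proof -
      have "\<bar>real N * D - D * x\<bar> = \<bar>D\<bar> * \<bar>real N - x\<bar>"
        by (simp add: abs_mult[symmetric] algebra_simps)
      also have "\<dots> \<le> \<bar>D\<bar> * x powr \<alpha>"
        using N x \<alpha> ge_one_powr_ge_zero[of x \<alpha>] by (intro mult_left_mono) auto
      finally show ?thesis .
    qed
    ultimately show "norm ((\<Sum>n | 1 \<le> n \<and> real n \<le> x. indicator S n) - D * x) \<le> (\<bar>C2\<bar> + \<bar>D\<bar>) * norm (x powr \<alpha>)"
      by (simp add: algebra_simps)
  qed
  then show ?thesis
    using conv dens unfolding D \<alpha>_def by (intro conjI)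
qed

end
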